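(* There exist a sequence $(n_i)_{i=1}^{\infty}$ of positive integers and absolute constants $c>0$, $C>0$ such that, for each $i \geq 1$, there is a triangle-free graph $G_i$ on $n_i$ vertices which is $(p_i, \beta_i)$-jumbled with $p_i \geq c\, n_i^{-1/3}$ and $\beta_i \leq C\sqrt{p_i n_i}\,\log n_i$.
   Context: All graphs are finite and simple. For a graph $G$ and $X \subseteq V(G)$, $e(X)$ denotes the number of edges of $G$ with both endpoints in $X$. A graph $G$ is said to be $(p,\beta)$-jumbled if $\left|e(X) - p\binom{|X|}{2}\right| \leq \beta |X|$ for all $X \subseteq V(G)$. *)

theory Defs
  imports Complex_Main
begin

definition simple_graph :: "'a set \<Rightarrow> 'a set set \<Rightarrow> bool" where
  "simple_graph V E \<longleftrightarrow> finite V \<and> (\<forall>e\<in>E. e \<subseteq> V \<and> card e = 2)"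

definition edges_in :: "'a set set \<Rightarrow> 'a set \<Rightarrow> nat" where
  "edges_in E X = card {e \<in> E. e \<subseteq> X}"

definition triangle_free :: "'a set set \<Rightarrow> bool" where
  "triangle_free E \<longleftrightarrow> \<not> (\<exists>a b c. {a, b} \<in> E \<and> {b, c} \<in> E \<and> {a, c} \<in> E)"

definition jumbled :: "'a set \<Rightarrow> 'a set set \<Rightarrow> real \<Rightarrow> real \<Rightarrow> bool" where
  "jumbled V E p \<beta> \<longleftrightarrow>
     (\<forall>X \<subseteq> V. \<bar>real (edges_in E X) - p * real (card X choose 2)\<bar> \<le> \<beta> * real (card X))"

end

theory Submission
  imports Defs "HOL-Library.Infinite_Set" "HOL-Computational_Algebra.Primes"
begin

text \<open>
  Let \<open>q\<close> be prime and consider in \<open>F\<^sub>q\<^sup>3\<close> the \<open>q\<^sup>3\<close> affine lines with a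
  direction of the form \<open>(1, k, k\<^sup>2)\<close>. Since three such directions are independent, pairwise
  collinear points lie on a common line. Bipartition every line at random and join points on
  opposite sides of a common line: the result is triangle-free.

  Encode the bipartitions by signs. For a set \<open>X\<close> of points, \<open>4 e(X) = P - W\<close>, where \<open>P\<close> is the
  sum of \<open>\<bar>X \<inter> l\<bar>\<^sup>2\<close> over the lines \<open>l\<close> and \<open>W\<close> is the sum of the squared sign
  sums of \<open>X \<inter> l\<close>. Expanding \<open>P\<close> in characters of \<open>F\<^sub>q\<^sup>3\<close>, and using that a nonzero
  character is trivial on at most two of the directions (roots of a quadratic), gives
  \<open>\<bar>X\<bar>\<^sup>2 / q \<le> P \<le> \<bar>X\<bar>\<^sup>2 / q + 2 q \<bar>X\<bar>\<close>. The exponential moment of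
  \<open>W / (4 q)\<close> is at most \<open>exp (\<bar>X\<bar> / 2)\<close>, so by a union bound over \<open>X\<close> some choice of signs
  has \<open>W = O(q \<bar>X\<bar> log q)\<close> for all \<open>X\<close>. Hence the graph is jumbled with density
  \<open>1 / (2 q)\<close> and \<open>\<beta> = O(q log q)\<close>.
\<close>

section \<open>Exponential moments of random signs\<close>

text \<open>Compares the Taylor coefficients of \<open>exp (x\<^sup>2 / 2)\<close> and
  \<open>cosh x\<close> in degree \<open>2 * n\<close>.\<close>

lemma two_power_fact_le_fact_double: "2 ^ n * fact n \<le> (fact (2 * n) :: real)"
proof (induction n)
  case (Suc n)
  have "2 ^ Suc n * fact (Suc n) = 2 * (real n + 1) * (2 ^ n * fact n)"
    by (simp add: algebra_simps)
  also have "\<dots> \<le> 2 * (real n + 1) * fact (2 * n)"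
    using Suc by (intro mult_left_mono) auto
  also have "\<dots> \<le> (2 * real n + 1) * (2 * (real n + 1) * fact (2 * n))"
    using mult_right_mono[of 1 "2 * real n + 1" "2 * (real n + 1) * fact (2 * n)"] by simp
  also have "\<dots> = fact (2 * Suc n)"
    by (simp add: algebra_simps)
  finally show ?case .
qed auto

text \<open>The two even power series are compared term by term. This is the sub-Gaussian bound for
  one random sign.\<close>

lemma cosh_le_exp_half_square: "cosh x \<le> exp (x\<^sup>2 / 2)" for x :: real
proof (rule sums_le)
  let ?f = "\<lambda>n. if even n then x ^ n /\<^sub>R fact n else 0"
  \<comment> \<open>The series from \<open>cosh_converges\<close> carries zeros at odd indices;
    reindexing drops them.\<close>
  have "(\<lambda>n. ?f (2 * n)) sums cosh x \<longleftrightarrow> ?f sums cosh x"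
    by (rule sums_mono_reindex) (auto simp: strict_mono_def elim!: evenE)
  then show "(\<lambda>n. ?f (2 * n)) sums cosh x"
    using cosh_converges by blast
  show "(\<lambda>n. (x\<^sup>2 / 2) ^ n /\<^sub>R fact n) sums exp (x\<^sup>2 / 2)"
    by (rule exp_converges)
  show "?f (2 * n) \<le> (x\<^sup>2 / 2) ^ n /\<^sub>R fact n" for n
  proof -
    have "x ^ (2 * n) / fact (2 * n) \<le> x ^ (2 * n) / (2 ^ n * fact n)"
      by (rule divide_left_mono[OF two_power_fact_le_fact_double]) auto
    moreover have "(x\<^sup>2 / 2) ^ n /\<^sub>R fact n = x ^ (2 * n) / (2 ^ n * fact n)"
      by (simp only: power_divide power_mult real_scaleR_def) (simp add: field_simps)
    moreover have "?f (2 * n) = x ^ (2 * n) / fact (2 * n)"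
      by (simp only: real_scaleR_def divide_inverse mult.commute dvd_triv_right if_True)
    ultimately show ?thesis
      by (simp only:)
  qed
qed

text \<open>Expanding the squares leaves cross terms \<open>T / N\<close> of both signs, hence a
  \<open>cosh\<close>, whose Gaussian bound raises the weight \<open>1 / N\<close> of
  \<open>T\<^sup>2\<close> only to \<open>1 / N + 1 / N\<^sup>2 \<le> 1 / (N - 1)\<close>.\<close>

lemma exp_square_shift_sum_le:
  fixes T N :: real
  assumes "N > 1"
  shows "exp ((T - 1)\<^sup>2 / (2 * N)) + exp ((T + 1)\<^sup>2 / (2 * N))
    \<le> 2 * exp (1 / (2 * N)) * exp (T\<^sup>2 / (2 * (N - 1)))"
proof -
  have "exp ((T - 1)\<^sup>2 / (2 * N)) + exp ((T + 1)\<^sup>2 / (2 * N))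
      = 2 * exp (1 / (2 * N)) * (exp (T\<^sup>2 / (2 * N)) * cosh (T / N))"
    using assms
    by (simp add: cosh_def exp_add[symmetric] power2_eq_square field_simps)
  also have "exp (T\<^sup>2 / (2 * N)) * cosh (T / N) \<le> exp (T\<^sup>2 / (2 * N)) * exp ((T / N)\<^sup>2 / 2)"
    by (intro mult_left_mono cosh_le_exp_half_square) auto
  also have "\<dots> = exp (T\<^sup>2 * (1 / N + 1 / N\<^sup>2) / 2)"
    by (simp add: exp_add[symmetric] field_simps)
  also have "\<dots> \<le> exp (T\<^sup>2 * (1 / (N - 1)) / 2)"
  proof -
    have "1 / N + 1 / N\<^sup>2 \<le> 1 / (N - 1)"
      using assms by (simp add: divide_simps power2_eq_square) (simp add: algebra_simps)
    then have "T\<^sup>2 * (1 / N + 1 / N\<^sup>2) \<le> T\<^sup>2 * (1 / (N - 1))"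
      by (intro mult_left_mono) auto
    then show ?thesis
      unfolding exp_le_cancel_iff by (rule divide_right_mono) simp
  qed
  also have "T\<^sup>2 * (1 / (N - 1)) / 2 = T\<^sup>2 / (2 * (N - 1))"
    by simp
  finally show ?thesis by simp
qed

text \<open>A subset encodes a sign pattern, so the expectation over uniform independent signs is,
  up to a power of 2, a sum over a powerset.\<close>

definition sign :: "'a set \<Rightarrow> 'a \<Rightarrow> real" where
  "sign A i = (if i \<in> A then 1 else -1)"

lemma sum_Pow_insert:
  assumes "finite S" "i \<notin> S"
  shows "sum f (Pow (insert i S)) = (\<Sum>A\<in>Pow S. f A + f (insert i A))"
proof -
  have "sum f (Pow (insert i S)) = sum f (Pow S) + sum f (insert i ` Pow S)"
    unfolding Pow_insert using assms by (intro sum.union_disjoint) auto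
  also have "sum f (insert i ` Pow S) = (\<Sum>A\<in>Pow S. f (insert i A))"
    using assms(2) by (subst sum.reindex) (auto simp: inj_on_def)
  finally show ?thesis by (simp add: sum.distrib)
qed

text \<open>Averaging out one sign of block \<open>b\<close> replaces the weight \<open>1 / (2 * N b)\<close> by
  at most \<open>1 / (2 * (N b - 1))\<close>, so the induction can be run with integral \<open>N\<close>.\<close>

lemma sum_Pow_exp_block_squares_le:
  fixes N :: "'b \<Rightarrow> nat" and M :: nat
  assumes "finite S" "finite B" "U \<subseteq> S" "g ` U \<subseteq> B" "M > 0"
    and "\<And>b. b \<in> B \<Longrightarrow> M + card {i \<in> U. g i = b} \<le> N b"
  shows "(\<Sum>A\<in>Pow S. exp (\<Sum>b\<in>B. (\<Sum>i\<in>{i \<in> U. g i = b}. sign A i)\<^sup>2 / (2 * real (N b))))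
    \<le> 2 ^ card S * exp (real (card U) / (2 * real M))"
  using assms(1,3,4,6)
proof (induction S arbitrary: U N rule: finite_induct)
  case empty
  then show ?case by simp
next
  case (insert i S)
  define T where "T U A b = (\<Sum>i\<in>{i \<in> U. g i = b}. sign A i)" for U A b
  define F where "F N U A = exp (\<Sum>b\<in>B. (T U A b)\<^sup>2 / (2 * real (N b)))" for N U A
  have T_insert: "T U (insert i A) b = T U A b" if "i \<notin> U" for U A b
    unfolding T_def using that by (intro sum.cong) (auto simp: sign_def)
  have "(\<Sum>A\<in>Pow S. F N U A + F N U (insert i A)) \<le> 2 ^ card (insert i S) * exp (real (card U) / (2 * real M))"
  proof (cases "i \<in> U")
    case False
    then have "U \<subseteq> S" using insert by auto
    then have "(\<Sum>A\<in>Pow S. F N U A) \<le> 2 ^ card S * exp (real (card U) / (2 * real M))"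
      unfolding F_def T_def using insert by blast
    moreover have "F N U (insert i A) = F N U A" for A
      using False by (simp add: F_def T_insert)
    ultimately show ?thesis
      using insert.hyps by (simp add: sum_distrib_left[symmetric])
  next
    case True
    define U' where "U' = U - {i}"
    define b where "b = g i"
    \<comment> \<open>\<open>U\<close> loses one element of block \<open>b\<close>, so
      \<open>N b\<close> may drop by one while the slack \<open>M\<close> is kept.\<close>
    define N' where "N' = N(b := N b - 1)"
    have U: "U = insert i U'" "i \<notin> U'" "U' \<subseteq> S"
      using True insert.prems(1) by (auto simp: U'_def)
    have finU': "finite U'"
      using U(3) insert.hyps(1) by (rule finite_subset)
    have bB: "b \<in> B" using True insert.prems(2) by (auto simp: b_def)
    have blk: "{j \<in> U. g j = b} = insert i {j \<in> U'. g j = b}"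
      using U by (auto simp: b_def)
    have blk': "{j \<in> U. g j = c} = {j \<in> U'. g j = c}" if "c \<noteq> b" for c
      using U that by (auto simp: b_def)
    have cardb: "M + Suc (card {j \<in> U'. g j = b}) \<le> N b"
      using insert.prems(3)[OF bB] U(2) finU' by (simp add: blk)
    have N': "M + card {j \<in> U'. g j = c} \<le> N' c" if "c \<in> B" for c
      using insert.prems(3)[OF that] cardb by (cases "c = b") (auto simp: N'_def blk')
    have IH: "(\<Sum>A\<in>Pow S. F N' U' A) \<le> 2 ^ card S * exp (real (card U') / (2 * real M))"
      unfolding F_def T_def using insert.prems(2) U(1,3) N' by (intro insert.IH) auto
    have step: "F N U A + F N U (insert i A) \<le> 2 * exp (1 / (2 * real M)) * F N' U' A"
      if A: "A \<in> Pow S" for A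
    proof -
      define R where "R = (\<Sum>c\<in>B - {b}. (T U' A c)\<^sup>2 / (2 * real (N c)))"
      \<comment> \<open>The sign of \<open>i\<close> is therefore -1 in \<open>A\<close> and +1 in
        \<open>insert i A\<close>.\<close>
      have iA: "i \<notin> A" using A insert.hyps(2) by auto
      have Tb: "T U A b = T U' A b - 1" "T U (insert i A) b = T U' A b + 1"
        using U(2) finU' iA T_insert[of U' A b]
        by (simp_all add: T_def blk) (simp_all add: sign_def)
      have Tc: "T U A c = T U' A c" "T U (insert i A) c = T U' A c" if "c \<noteq> b" for c
        using that U(2) T_insert[of U' A c] by (simp_all add: T_def blk')
      have R: "(\<Sum>c\<in>B - {b}. (T U A c)\<^sup>2 / (2 * real (N c))) = R"
        "(\<Sum>c\<in>B - {b}. (T U (insert i A) c)\<^sup>2 / (2 * real (N c))) = R"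
        "(\<Sum>c\<in>B - {b}. (T U' A c)\<^sup>2 / (2 * real (N' c))) = R"
        unfolding R_def by (auto simp: Tc N'_def intro!: sum.cong)
      have F1: "F N U A = exp ((T U' A b - 1)\<^sup>2 / (2 * N b)) * exp R"
        using assms(2) bB
        by (simp add: F_def sum.remove[of B b] Tb exp_add R)
      have F2: "F N U (insert i A) = exp ((T U' A b + 1)\<^sup>2 / (2 * N b)) * exp R"
        using assms(2) bB
        by (simp add: F_def sum.remove[of B b] Tb exp_add R)
      have F3: "F N' U' A = exp ((T U' A b)\<^sup>2 / (2 * (real (N b) - 1))) * exp R"
        using assms(2) bB cardb
        by (simp add: F_def sum.remove[of B b] exp_add R) (simp add: N'_def of_nat_diff)
      have "F N U A + F N U (insert i A)
          \<le> (2 * exp (1 / (2 * N b)) * exp ((T U' A b)\<^sup>2 / (2 * (real (N b) - 1)))) * exp R"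
        unfolding F1 F2 distrib_right[symmetric]
        using exp_square_shift_sum_le[of "real (N b)" "T U' A b"] cardb assms(5)
        by (intro mult_right_mono) auto
      also have "\<dots> = 2 * exp (1 / (2 * N b)) * F N' U' A"
        by (simp add: F3)
      \<comment> \<open>Since \<open>N b > M\<close>, each averaged sign costs at most
        \<open>exp (1 / (2 * M))\<close>; over all of \<open>U\<close> these costs multiply to the
        claimed factor.\<close>
      also have "\<dots> \<le> 2 * exp (1 / (2 * real M)) * F N' U' A"
        using cardb assms(5)
        by (intro mult_right_mono mult_left_mono) (auto simp: F_def intro!: divide_left_mono)
      finally show ?thesis .
    qed
    have "(\<Sum>A\<in>Pow S. F N U A + F N U (insert i A)) \<le> (\<Sum>A\<in>Pow S. 2 * exp (1 / (2 * real M)) * F N' U' A)"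
      by (intro sum_mono step)
    also have "\<dots> = 2 * exp (1 / (2 * real M)) * (\<Sum>A\<in>Pow S. F N' U' A)"
      by (simp add: sum_distrib_left)
    also have "\<dots> \<le> 2 * exp (1 / (2 * real M)) * (2 ^ card S * exp (real (card U') / (2 * real M)))"
      using IH by (intro mult_left_mono) auto
    also have "\<dots> = 2 ^ card (insert i S) * exp (real (card U) / (2 * real M))"
      using insert.hyps U(1,2) finU' by (simp add: add_divide_distrib exp_add)
    finally show ?thesis .
  qed
  then show ?case
    using insert.hyps by (simp add: sum_Pow_insert F_def T_def)
qed

lemma exists_le_average:
  fixes f :: "'a \<Rightarrow> real"
  assumes "finite S" "S \<noteq> {}" "sum f S \<le> real (card S) * m"
  shows "\<exists>x\<in>S. f x \<le> m"
proof (rule ccontr)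
  assume "\<not> ?thesis"
  then have "(\<Sum>x\<in>S. m) < sum f S"
    using assms by (intro sum_strict_mono) auto
  then show False using assms(3) by simp
qed

lemma sum_Pow_power_card:
  fixes z :: "'a :: comm_semiring_1"
  assumes "finite V"
  shows "(\<Sum>X\<in>Pow V. z ^ card X) = (1 + z) ^ card V"
  using assms
proof (induction V rule: finite_induct)
  case (insert v V)
  have "(\<Sum>X\<in>Pow (insert v V). z ^ card X) = (\<Sum>X\<in>Pow V. z ^ card X + z ^ card (insert v X))"
    using insert by (simp add: sum_Pow_insert)
  also have "\<dots> = (\<Sum>X\<in>Pow V. (1 + z) * z ^ card X)"
  proof (rule sum.cong)
    fix X assume "X \<in> Pow V"
    then have "finite X" "v \<notin> X" using insert finite_subset by auto
    then show "z ^ card X + z ^ card (insert v X) = (1 + z) * z ^ card X"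
      by (simp add: algebra_simps)
  qed auto
  also have "\<dots> = (1 + z) ^ card (insert v V)"
    using insert by (simp add: sum_distrib_left[symmetric])
  finally show ?case .
qed auto

section \<open>Pair counts on lines and the choice of signs\<close>

definition collinear_pairs :: "('a \<Rightarrow> 'k \<Rightarrow> 'l) \<Rightarrow> 'k set \<Rightarrow> 'a set \<Rightarrow> real" where
  "collinear_pairs L K X = (\<Sum>k\<in>K. \<Sum>x\<in>X. \<Sum>y\<in>X. of_bool (L x k = L y k))"

text \<open>With \<open>collinear_pairs\<close>, these are \<open>W\<close> and \<open>P\<close> of
  the overview, the squares being written as sums over ordered pairs with the diagonal
  included.\<close>

definition signed_pairs :: "('a \<Rightarrow> 'k \<Rightarrow> 'l) \<Rightarrow> 'k set \<Rightarrow> ('a \<times> 'k) set \<Rightarrow> 'a set \<Rightarrow> real" where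
  "signed_pairs L K A X = (\<Sum>k\<in>K. \<Sum>x\<in>X. \<Sum>y\<in>X. of_bool (L x k = L y k) * sign A (x, k) * sign A (y, k))"

text \<open>A block is a line tagged with its direction \<open>k\<close>; squaring its sign sum
  produces the pairs on it. Blocks are indexed over all of \<open>V\<close>, independently of
  \<open>X\<close>; those missing \<open>X\<close> contribute 0.\<close>

lemma signed_pairs_eq_block_squares:
  assumes "finite K" "finite V" "X \<subseteq> V"
  shows "signed_pairs L K A X = (\<Sum>b\<in>(\<lambda>(x, k). (k, L x k)) ` (V \<times> K).
    (\<Sum>i\<in>{i \<in> X \<times> K. (\<lambda>(x, k). (k, L x k)) i = b}. sign A i)\<^sup>2)"
proof -
  define g where "g = (\<lambda>(x, k). (k, L x k))"
  have fin: "finite X" using assms finite_subset by auto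
  let ?P = "{(i, j) \<in> (X \<times> K) \<times> (X \<times> K). g i = g j}"
  have "(\<Sum>b\<in>g ` (V \<times> K). (\<Sum>i\<in>{i \<in> X \<times> K. g i = b}. sign A i)\<^sup>2)
      = (\<Sum>b\<in>g ` (V \<times> K). \<Sum>i\<in>{i \<in> X \<times> K. g i = b}. \<Sum>j\<in>{j \<in> X \<times> K. g i = g j}. sign A i * sign A j)"
    unfolding power2_eq_square sum_product
    by (intro sum.cong) auto
  also have "\<dots> = (\<Sum>i\<in>X \<times> K. \<Sum>j\<in>{j \<in> X \<times> K. g i = g j}. sign A i * sign A j)"
    using assms fin by (intro sum.group) auto
  also have "\<dots> = (\<Sum>(x, k)\<in>X \<times> K. \<Sum>y\<in>X. of_bool (L x k = L y k) * sign A (x, k) * sign A (y, k))"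
  proof (intro sum.cong refl, clarsimp)
    fix x k assume "x \<in> X" "k \<in> K"
    have "(\<Sum>y\<in>X. of_bool (L x k = L y k) * sign A (x, k) * sign A (y, k))
        = (\<Sum>y\<in>{y \<in> X. L x k = L y k}. sign A (x, k) * sign A (y, k))"
      using fin by (intro sum.mono_neutral_cong_right) auto
    also have "\<dots> = (\<Sum>j\<in>{j \<in> X \<times> K. g (x, k) = g j}. sign A (x, k) * sign A j)"
      using \<open>k \<in> K\<close>
      by (intro sum.reindex_bij_witness[of _ fst "\<lambda>y. (y, k)"]) (auto simp: g_def)
    finally show "(\<Sum>j\<in>{j \<in> X \<times> K. g (x, k) = g j}. sign A (x, k) * sign A j)
      = (\<Sum>y\<in>X. of_bool (L x k = L y k) * sign A (x, k) * sign A (y, k))" by simp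
  qed
  also have "\<dots> = signed_pairs L K A X"
    unfolding signed_pairs_def sum.cartesian_product[symmetric] by (rule sum.swap)
  finally show ?thesis by (simp add: g_def)
qed

lemma signed_pairs_nonneg:
  assumes "finite K" "finite X"
  shows "signed_pairs L K A X \<ge> 0"
  unfolding signed_pairs_eq_block_squares[OF assms order_refl] by (intro sum_nonneg) auto

text \<open>A weighted union bound: averaging over \<open>A\<close> yields one \<open>A\<close> for
  which the weighted sum of \<open>H A X\<close> over all \<open>X\<close> is at most
  \<open>exp 1\<close>. This bounds every term at once, and logarithms give the claim.\<close>

lemma exists_signs_small_signed_pairs:
  fixes L :: "'a \<Rightarrow> 'k \<Rightarrow> 'l"
  assumes fin: "finite V" "V \<noteq> {}" "finite K" "card K = q" and q: "q > 0"
    and line: "\<And>k l. k \<in> K \<Longrightarrow> card {x \<in> V. L x k = l} \<le> q"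
  shows "\<exists>A. \<forall>X\<subseteq>V. X \<noteq> {} \<longrightarrow> signed_pairs L K A X \<le> 4 * real q * real (card X) * (3 / 2 + ln (real (card V)))"
proof -
  define n where "n = card V"
  have n: "n > 0" using fin by (auto simp: n_def card_gt_0_iff)
  define g where "g = (\<lambda>(x, k). (k, L x k))"
  \<comment> \<open>The first factor cancels the moment bound \<open>exp (card X / 2)\<close>; the
    second pays for the number of sets, as the powers of \<open>1 / n\<close> sum to
    \<open>(1 + 1 / n) ^ n \<le> exp 1\<close>.\<close>
  define w where "w X = exp (- (card X / 2)) * (1 / n) ^ card X" for X :: "'a set"
  define H where "H A X = exp (signed_pairs L K A X / (4 * q))" for A X
  let ?S = "V \<times> K"
  have moment: "(\<Sum>A\<in>Pow ?S. H A X) \<le> 2 ^ card ?S * exp (card X / 2)" if X: "X \<subseteq> V" for X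
  proof -
    have finX: "finite X" using X fin finite_subset by auto
    \<comment> \<open>A line has at most \<open>q\<close> points, so the moment bound applies with
      \<open>M = q\<close> and every \<open>N b = 2 * q\<close>; hence the divisor
      \<open>4 * q\<close> in \<open>H\<close>.\<close>
    have blocks: "q + card {i \<in> X \<times> K. g i = b} \<le> 2 * q" if b_in: "b \<in> g ` ?S" for b
    proof -
      obtain k l where b: "b = (k, l)" "k \<in> K" using b_in by (auto simp: g_def)
      have "card {i \<in> X \<times> K. g i = b} \<le> card ((\<lambda>x. (x, k)) ` {x \<in> V. L x k = l})"
        using fin X b by (intro card_mono) (auto simp: g_def)
      also have "\<dots> \<le> card {x \<in> V. L x k = l}" using fin by (intro card_image_le) auto
      finally show ?thesis using line[of k l] b by simp
    qed
    have "(\<Sum>A\<in>Pow ?S. exp (\<Sum>b\<in>g ` ?S. (\<Sum>i\<in>{i \<in> X \<times> K. g i = b}. sign A i)\<^sup>2 / (2 * real (2 * q))))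
        \<le> 2 ^ card ?S * exp (real (card (X \<times> K)) / (2 * real q))"
      using fin X q blocks
      by (intro sum_Pow_exp_block_squares_le) auto
    then show ?thesis
      using q fin X
      by (simp add: H_def signed_pairs_eq_block_squares[of K V X] g_def[symmetric]
          sum_divide_distrib card_cartesian_product)
  qed
  have "(\<Sum>A\<in>Pow ?S. \<Sum>X\<in>Pow V. w X * H A X) = (\<Sum>X\<in>Pow V. w X * (\<Sum>A\<in>Pow ?S. H A X))"
    unfolding sum_distrib_left by (rule sum.swap)
  also have "\<dots> \<le> (\<Sum>X\<in>Pow V. w X * (2 ^ card ?S * exp (card X / 2)))"
    by (intro sum_mono mult_left_mono moment) (auto simp: w_def)
  also have "\<dots> = (\<Sum>X\<in>Pow V. 2 ^ card ?S * (1 / n) ^ card X)"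
    by (intro sum.cong) (auto simp: w_def exp_minus)
  also have "\<dots> = 2 ^ card ?S * (1 + 1 / n) ^ n"
    using fin by (simp add: sum_distrib_left[symmetric] sum_Pow_power_card n_def)
  also have "\<dots> \<le> 2 ^ card ?S * exp 1"
    using exp_ge_one_plus_x_over_n_power_n[of n 1] n
    by (intro mult_left_mono) auto
  finally have "(\<Sum>A\<in>Pow ?S. \<Sum>X\<in>Pow V. w X * H A X) \<le> card (Pow ?S) * exp 1"
    using fin by (simp add: card_Pow)
  then have "\<exists>A\<in>Pow ?S. (\<Sum>X\<in>Pow V. w X * H A X) \<le> exp 1"
    using fin by (intro exists_le_average) auto
  then obtain A where A: "(\<Sum>X\<in>Pow V. w X * H A X) \<le> exp 1"
    by blast
  have "signed_pairs L K A X \<le> 4 * real q * real (card X) * (3 / 2 + ln (real (card V)))"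
    if X: "X \<subseteq> V" "X \<noteq> {}" for X
  proof -
    have "card X \<ge> 1" using X fin finite_subset by (auto simp: Suc_le_eq card_gt_0_iff)
    have "w X * H A X \<le> (\<Sum>X\<in>Pow V. w X * H A X)"
      using X fin by (intro member_le_sum) (auto simp: w_def H_def)
    with A have "w X * H A X \<le> exp 1" by simp
    then have "ln (w X * H A X) \<le> ln (exp 1)"
      using n by (subst ln_le_cancel_iff) (auto simp: w_def H_def)
    moreover have "ln (w X * H A X) = - (card X / 2) - card X * ln n + signed_pairs L K A X / (4 * q)"
      using n by (simp add: w_def H_def ln_mult ln_realpow ln_div)
    ultimately have "signed_pairs L K A X / (4 * q) \<le> 1 + card X / 2 + card X * ln n"
      by simp
    \<comment> \<open>The constant 1 is at most \<open>card X\<close>, which turns 1/2 into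
      3/2.\<close>
    also have "\<dots> \<le> card X * (3 / 2 + ln n)"
      using \<open>card X \<ge> 1\<close> by (simp add: algebra_simps)
    finally show ?thesis
      using q by (simp add: n_def divide_le_eq mult_ac)
  qed
  then show ?thesis by blast
qed

section \<open>Lines with directions on the moment curve\<close>

text \<open>The basic additive character mod \<open>q\<close>, taken on integers so that residues
  are handled by divisibility.\<close>

definition unity_char :: "nat \<Rightarrow> int \<Rightarrow> complex" where
  "unity_char q m = cis (2 * pi * real_of_int m / real q)"

lemma unity_char_add: "unity_char q (m + n) = unity_char q m * unity_char q n"
  by (simp add: unity_char_def cis_mult add_divide_distrib ring_distribs)

lemma unity_char_minus: "unity_char q (- m) = cnj (unity_char q m)"
  by (simp add: unity_char_def cis_cnj)

lemma unity_char_eq_1_iff: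
  assumes "q > 0"
  shows "unity_char q m = 1 \<longleftrightarrow> int q dvd m"
proof
  assume "unity_char q m = 1"
  then have "cos (2 * pi * real_of_int m / real q) = 1"
    by (simp add: unity_char_def complex_eq_iff)
  then obtain j :: int where "2 * pi * real_of_int m / real q = of_int j * 2 * pi"
    by (auto simp: cos_one_2pi_int)
  then have "real_of_int m = real_of_int (int q * j)"
    using assms by (simp add: field_simps)
  then show "int q dvd m"
    by (metis dvd_triv_left of_int_eq_iff)
next
  assume "int q dvd m"
  then obtain j where "m = int q * j" by blast
  then have "2 * pi * real_of_int m / real q = 2 * pi * of_int j"
    using assms by simp
  then show "unity_char q m = 1"
    by (simp add: unity_char_def complex_eq_iff)
qed

lemma unity_char_cong:
  assumes "q > 0" "m mod int q = n mod int q"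
  shows "unity_char q m = unity_char q n"
proof -
  have "unity_char q (m - n) = 1"
    using assms by (simp add: unity_char_eq_1_iff mod_eq_dvd_iff)
  then show ?thesis
    using unity_char_add[of q "m - n" n] by simp
qed

text \<open>Orthogonality: a geometric sum whose ratio is a \<open>q\<close>-th root of unity. It
  replaces divisibility conditions by character sums.\<close>

lemma sum_unity_char:
  assumes "q > 0"
  shows "(\<Sum>r\<in>{0..<int q}. unity_char q (r * v)) = of_nat q * of_bool (int q dvd v)"
proof -
  define z where "z = unity_char q v"
  have power: "unity_char q (int j * v) = z ^ j" for j
    by (induction j) (simp_all add: z_def unity_char_add ring_distribs, simp add: unity_char_def)
  have "(\<Sum>r\<in>{0..<int q}. unity_char q (r * v)) = (\<Sum>j<q. z ^ j)"
    by (intro sum.reindex_bij_witness[of _ int nat]) (auto simp flip: power)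
  also have "\<dots> = of_nat q * of_bool (int q dvd v)"
  proof (cases "int q dvd v")
    case True
    then have "z = 1" using assms by (simp add: z_def unity_char_eq_1_iff)
    then show ?thesis using True by simp
  next
    case False
    then have "z \<noteq> 1" using assms by (simp add: z_def unity_char_eq_1_iff)
    moreover have "z ^ q = 1"
      using assms by (simp add: power[symmetric] unity_char_eq_1_iff)
    ultimately show ?thesis using False by (simp add: geometric_sum)
  qed
  finally show ?thesis .
qed

section \<open>Points as triples of base \<open>q\<close> digits, and their lines\<close>

definition crd1 :: "nat \<Rightarrow> nat \<Rightarrow> int" where "crd1 q x = int (x mod q)"
definition crd2 :: "nat \<Rightarrow> nat \<Rightarrow> int" where "crd2 q x = int (x div q mod q)"
definition crd3 :: "nat \<Rightarrow> nat \<Rightarrow> int" where "crd3 q x = int (x div q div q)"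

lemma crd_bounds:
  assumes "q > 0" "x < q ^ 3"
  shows "crd1 q x \<in> {0..<int q}" "crd2 q x \<in> {0..<int q}" "crd3 q x \<in> {0..<int q}"
  using assms
  by (simp_all add: crd1_def crd2_def crd3_def less_mult_imp_div_less power3_eq_cube)

lemma dvd_diff_residues_iff:
  assumes "a \<in> {0..<int q}" "b \<in> {0..<int q}"
  shows "int q dvd a - b \<longleftrightarrow> a = b"
  using assms by (metis atLeastLessThan_iff mod_eq_dvd_iff mod_pos_pos_trivial)

lemma crd_inject:
  assumes "q > 0" "x < q ^ 3" "y < q ^ 3"
    and "int q dvd crd1 q x - crd1 q y" "int q dvd crd2 q x - crd2 q y" "int q dvd crd3 q x - crd3 q y"
  shows "x = y"
proof -
  have "crd1 q x = crd1 q y" "crd2 q x = crd2 q y" "crd3 q x = crd3 q y"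
    using assms crd_bounds[of q x] crd_bounds[of q y] by (simp_all add: dvd_diff_residues_iff)
  then have "x mod q = y mod q" "x div q mod q = y div q mod q" "x div q div q = y div q div q"
    by (simp_all add: crd1_def crd2_def crd3_def)
  then show "x = y" by (metis div_mult_mod_eq)
qed

text \<open>A point \<open>x < q ^ 3\<close> encodes \<open>(a, b, c) \<in> F\<^sub>q\<^sup>3\<close>;
  \<open>line q x k\<close> names the affine line through it with direction \<open>(1, k, k\<^sup>2)\<close>.\<close>

definition line :: "nat \<Rightarrow> nat \<Rightarrow> int \<Rightarrow> int \<times> int" where
  "line q x k = ((crd2 q x - k * crd1 q x) mod int q, (crd3 q x - k\<^sup>2 * crd1 q x) mod int q)"

text \<open>Expresses collinearity through the difference of the two points, a multiple of
  \<open>(1, k, k\<^sup>2)\<close> mod \<open>q\<close>; the linear algebra and the character sums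
  both start from this form.\<close>

lemma line_eq_iff:
  "line q x k = line q y k \<longleftrightarrow>
     int q dvd (crd2 q x - crd2 q y) - k * (crd1 q x - crd1 q y) \<and>
     int q dvd (crd3 q x - crd3 q y) - k\<^sup>2 * (crd1 q x - crd1 q y)"
  by (simp add: line_def mod_eq_dvd_iff algebra_simps)

text \<open>The direction has first coordinate 1, so the first coordinate parametrises a
  line.\<close>

lemma line_eq_crd1_dvd_imp_eq:
  assumes "q > 0" "x < q ^ 3" "y < q ^ 3" "line q x k = line q y k" "int q dvd crd1 q x - crd1 q y"
  shows "x = y"
proof (rule crd_inject)
  show "int q dvd crd2 q x - crd2 q y" "int q dvd crd3 q x - crd3 q y"
    using assms(4,5) unfolding line_eq_iff by (metis dvd_diff_right_iff dvd_mult dvd_diff_left_iff)+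
qed (use assms in auto)

lemma card_line_le:
  assumes "q > 0"
  shows "card {x \<in> {..<q ^ 3}. line q x k = l} \<le> q"
proof -
  have "inj_on (crd1 q) {x \<in> {..<q ^ 3}. line q x k = l}"
    using assms by (auto simp: inj_on_def intro!: line_eq_crd1_dvd_imp_eq[of q _ _ k])
  moreover have "crd1 q ` {x \<in> {..<q ^ 3}. line q x k = l} \<subseteq> {0..<int q}"
    using assms crd_bounds(1) by blast
  ultimately have "card {x \<in> {..<q ^ 3}. line q x k = l} \<le> card {0..<int q}"
    by (rule card_inj_on_le) auto
  then show ?thesis by simp
qed

context
  fixes q :: nat
  assumes q: "prime q"
begin

lemma q_pos: "q > 0"
  using q by (rule prime_gt_0_nat)

lemma dvd_mult_iff: "int q dvd a * b \<longleftrightarrow> int q dvd a \<or> int q dvd b"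
  using q by (simp add: prime_dvd_mult_iff)

text \<open>Subtracting the second-coordinate conditions leaves \<open>(j - k) * ?d\<close>, with
  \<open>?d\<close> nonzero mod \<open>q\<close> for distinct points. So a pair of points has at
  most one direction, and edges are not counted repeatedly.\<close>

lemma two_lines_eq:
  assumes "x < q ^ 3" "y < q ^ 3" "x \<noteq> y" "j \<in> {0..<int q}" "k \<in> {0..<int q}"
    and "line q x j = line q y j" "line q x k = line q y k"
  shows "j = k"
proof -
  let ?d = "crd1 q x - crd1 q y"
  have "int q dvd (crd2 q x - crd2 q y - k * ?d) - (crd2 q x - crd2 q y - j * ?d)"
    using assms(6,7) unfolding line_eq_iff by (elim conjE) (rule dvd_diff)
  also have "\<dots> = (j - k) * ?d" by (simp add: algebra_simps)
  finally have "int q dvd j - k \<or> int q dvd ?d" by (simp only: dvd_mult_iff)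
  moreover have "\<not> int q dvd ?d"
    using assms line_eq_crd1_dvd_imp_eq[OF q_pos] by blast
  ultimately show ?thesis using assms by (simp add: dvd_diff_residues_iff)
qed

text \<open>Any three distinct directions \<open>(1, k, k\<^sup>2)\<close> are linearly independent (Vandermonde),
  so the only triangles of collinear points are contained in a line.\<close>

lemma triangle_direction_repeats:
  assumes "x < q ^ 3" "y < q ^ 3" "x \<noteq> y"
    and "i \<in> {0..<int q}" "j \<in> {0..<int q}" "k \<in> {0..<int q}"
    and "line q x i = line q y i" "line q y j = line q z j" "line q z k = line q x k"
  shows "i = j \<or> i = k"
proof -
  define D where "D u v t = crd2 q u - crd2 q v - t * (crd1 q u - crd1 q v)" for u v t
  define D' where "D' u v t = crd3 q u - crd3 q v - t\<^sup>2 * (crd1 q u - crd1 q v)" for u v t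
  have "int q dvd D x y i" "int q dvd D y z j" "int q dvd D z x k"
    "int q dvd D' x y i" "int q dvd D' y z j" "int q dvd D' z x k"
    using assms(7-9) unfolding line_eq_iff D_def D'_def by auto
  \<comment> \<open>The weights are coefficients of \<open>(t - j) * (t - k)\<close>, which cancels
    the sides with directions \<open>j\<close> and \<open>k\<close>; its constant term enters
    because the three first-coordinate differences sum to 0.\<close>
  then have "int q dvd (j + k) * (D x y i + D y z j + D z x k) - (D' x y i + D' y z j + D' z x k)"
    by (intro dvd_diff dvd_mult dvd_add)
  also have "\<dots> = (i - j) * ((i - k) * (crd1 q x - crd1 q y))"
    unfolding D_def D'_def by algebra
  finally have "int q dvd i - j \<or> int q dvd i - k \<or> int q dvd crd1 q x - crd1 q y"
    by (simp only: dvd_mult_iff)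
  moreover have "\<not> int q dvd crd1 q x - crd1 q y"
    using assms line_eq_crd1_dvd_imp_eq[OF q_pos] by blast
  ultimately show ?thesis using assms by (simp add: dvd_diff_residues_iff)
qed

text \<open>Rotating the triangle shows that no direction differs from both others, so all three
  agree.\<close>

lemma triangle_same_direction:
  assumes "x < q ^ 3" "y < q ^ 3" "z < q ^ 3" "x \<noteq> y" "y \<noteq> z" "z \<noteq> x"
    and "i \<in> {0..<int q}" "j \<in> {0..<int q}" "k \<in> {0..<int q}"
    and "line q x i = line q y i" "line q y j = line q z j" "line q z k = line q x k"
  shows "i = j" "j = k"
  using triangle_direction_repeats[of x y i j k z] triangle_direction_repeats[of y z j k i x]
    triangle_direction_repeats[of z x k i j y] assms by auto

section \<open>Counting collinear pairs by Fourier analysis\<close>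

definition fourier :: "nat set \<Rightarrow> int \<Rightarrow> int \<Rightarrow> int \<Rightarrow> complex" where
  "fourier X u r s = (\<Sum>x\<in>X. unity_char q (u * crd1 q x + r * crd2 q x + s * crd3 q x))"

text \<open>Brings the frequency \<open>- (r * k + s * k\<^sup>2)\<close> back into the range of
  summation of \<open>parseval\<close>.\<close>

lemma fourier_mod: "fourier X (u mod int q) r s = fourier X u r s"
  unfolding fourier_def
proof (intro sum.cong refl unity_char_cong q_pos)
  show "(u mod int q * crd1 q x + r * crd2 q x + s * crd3 q x) mod int q
    = (u * crd1 q x + r * crd2 q x + s * crd3 q x) mod int q" for x
    by (intro mod_add_cong mod_mult_cong) simp_all
qed

lemma norm_fourier_square:
  "complex_of_real ((cmod (fourier X u r s))\<^sup>2) = (\<Sum>x\<in>X. \<Sum>y\<in>X. unity_char q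
     (u * (crd1 q x - crd1 q y) + r * (crd2 q x - crd2 q y) + s * (crd3 q x - crd3 q y)))"
  unfolding complex_norm_square fourier_def cnj_sum sum_product
  by (intro sum.cong refl)
    (simp only: unity_char_minus[symmetric] unity_char_add[symmetric], simp add: algebra_simps)

text \<open>The sum over frequencies factors into three orthogonality sums, which together detect
  \<open>x = y\<close>.\<close>

lemma parseval:
  assumes "X \<subseteq> {..<q ^ 3}"
  shows "(\<Sum>r\<in>{0..<int q}. \<Sum>s\<in>{0..<int q}. \<Sum>u\<in>{0..<int q}. (cmod (fourier X u r s))\<^sup>2)
    = real q ^ 3 * card X"
proof -
  let ?K = "{0..<int q}"
  let ?e = "unity_char q"
  have finX: "finite X" using assms finite_subset by blast
  have "complex_of_real (\<Sum>r\<in>?K. \<Sum>s\<in>?K. \<Sum>u\<in>?K. (cmod (fourier X u r s))\<^sup>2)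
      = (\<Sum>r\<in>?K. \<Sum>s\<in>?K. \<Sum>u\<in>?K. \<Sum>x\<in>X. \<Sum>y\<in>X. ?e (r * (crd2 q x - crd2 q y))
           * (?e (s * (crd3 q x - crd3 q y)) * ?e (u * (crd1 q x - crd1 q y))))"
    by (simp only: of_real_sum norm_fourier_square unity_char_add mult_ac)
  also have "\<dots> = (\<Sum>x\<in>X. \<Sum>y\<in>X. \<Sum>r\<in>?K. \<Sum>s\<in>?K. \<Sum>u\<in>?K. ?e (r * (crd2 q x - crd2 q y))
           * (?e (s * (crd3 q x - crd3 q y)) * ?e (u * (crd1 q x - crd1 q y))))"
    by (simp only: sum.swap[of _ X ?K])
  also have "\<dots> = (\<Sum>x\<in>X. \<Sum>y\<in>X. (\<Sum>r\<in>?K. ?e (r * (crd2 q x - crd2 q y)))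
           * ((\<Sum>s\<in>?K. ?e (s * (crd3 q x - crd3 q y))) * (\<Sum>u\<in>?K. ?e (u * (crd1 q x - crd1 q y)))))"
    by (simp only: sum_distrib_left[symmetric] sum_distrib_right[symmetric])
  also have "\<dots> = (\<Sum>x\<in>X. \<Sum>y\<in>X. of_nat q ^ 3 * of_bool (x = y))"
  proof (intro sum.cong refl)
    fix x y assume "x \<in> X" "y \<in> X"
    then have "x = y \<longleftrightarrow> int q dvd crd2 q x - crd2 q y \<and> int q dvd crd3 q x - crd3 q y
        \<and> int q dvd crd1 q x - crd1 q y"
      using crd_inject[OF q_pos, of x y] assms by auto
    then show "(\<Sum>r\<in>?K. ?e (r * (crd2 q x - crd2 q y)))
           * ((\<Sum>s\<in>?K. ?e (s * (crd3 q x - crd3 q y))) * (\<Sum>u\<in>?K. ?e (u * (crd1 q x - crd1 q y))))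
        = of_nat q ^ 3 * of_bool (x = y)"
      by (simp only: sum_unity_char[OF q_pos] of_bool_conj) (simp add: power3_eq_cube)
  qed
  also have "\<dots> = of_nat q ^ 3 * of_nat (card X)"
    using finX by (simp add: sum_distrib_left[symmetric] of_bool_def)
  also have "\<dots> = complex_of_real (real q ^ 3 * card X)"
    by simp
  finally show ?thesis
    by (simp only: of_real_eq_iff)
qed

text \<open>The two divisibility conditions of \<open>line_eq_iff\<close> are detected by sums over
  \<open>r\<close> and \<open>s\<close>, each costing a factor \<open>q\<close>. The frequencies
  that appear are those orthogonal to the direction \<open>(1, k, k\<^sup>2)\<close>.\<close>

lemma collinear_pairs_fourier:
  "real q ^ 2 * collinear_pairs (line q) {0..<int q} X = (\<Sum>r\<in>{0..<int q}. \<Sum>s\<in>{0..<int q}. \<Sum>k\<in>{0..<int q}.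
     (cmod (fourier X (- (r * k + s * k\<^sup>2)) r s))\<^sup>2)"
proof -
  let ?K = "{0..<int q}"
  let ?e = "unity_char q"
  let ?b = "\<lambda>k x y. (crd2 q x - crd2 q y) - k * (crd1 q x - crd1 q y)"
  let ?c = "\<lambda>k x y. (crd3 q x - crd3 q y) - k\<^sup>2 * (crd1 q x - crd1 q y)"
  have of_bool: "complex_of_real (of_bool P) = of_bool P" for P
    by simp
  have "complex_of_real (real q ^ 2 * collinear_pairs (line q) {0..<int q} X)
      = (\<Sum>k\<in>?K. \<Sum>x\<in>X. \<Sum>y\<in>X. of_nat q ^ 2 * of_bool (line q x k = line q y k))"
    by (simp add: collinear_pairs_def sum_distrib_left of_bool)
  also have "\<dots> = (\<Sum>k\<in>?K. \<Sum>x\<in>X. \<Sum>y\<in>X. (\<Sum>r\<in>?K. ?e (r * ?b k x y)) * (\<Sum>s\<in>?K. ?e (s * ?c k x y)))"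
    by (intro sum.cong refl)
      (simp only: sum_unity_char[OF q_pos] line_eq_iff of_bool_conj, simp add: power2_eq_square)
  also have "\<dots> = (\<Sum>k\<in>?K. \<Sum>x\<in>X. \<Sum>y\<in>X. \<Sum>r\<in>?K. \<Sum>s\<in>?K. ?e (r * ?b k x y + s * ?c k x y))"
    by (simp only: sum_product unity_char_add)
  also have "\<dots> = (\<Sum>k\<in>?K. \<Sum>r\<in>?K. \<Sum>s\<in>?K. \<Sum>x\<in>X. \<Sum>y\<in>X. ?e (r * ?b k x y + s * ?c k x y))"
    by (simp only: sum.swap[of _ ?K X])
  also have "\<dots> = (\<Sum>k\<in>?K. \<Sum>r\<in>?K. \<Sum>s\<in>?K. complex_of_real ((cmod (fourier X (- (r * k + s * k\<^sup>2)) r s))\<^sup>2))"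
    unfolding norm_fourier_square
    by (intro sum.cong refl arg_cong[of _ _ ?e]) (simp add: algebra_simps)
  also have "\<dots> = (\<Sum>r\<in>?K. \<Sum>s\<in>?K. \<Sum>k\<in>?K. complex_of_real ((cmod (fourier X (- (r * k + s * k\<^sup>2)) r s))\<^sup>2))"
    by (rule trans[OF sum.swap sum.cong[OF refl sum.swap]])
  finally show ?thesis
    by (simp only: of_real_sum[symmetric] of_real_eq_iff)
qed

text \<open>For three arguments with the same value, divided differences of the quadratic force
  first \<open>s\<close> and then \<open>r\<close> to vanish mod \<open>q\<close>. Hence a frequency
  with \<open>(r, s) \<noteq> (0, 0)\<close> belongs to at most two directions.\<close>

lemma card_quadratic_fibre_le:
  assumes "r \<in> {0..<int q}" "s \<in> {0..<int q}" "(r, s) \<noteq> (0, 0)"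
  shows "card {k \<in> {0..<int q}. - (r * k + s * k\<^sup>2) mod int q = u} \<le> 2"
proof (rule ccontr)
  let ?F = "{k \<in> {0..<int q}. - (r * k + s * k\<^sup>2) mod int q = u}"
  assume "\<not> card ?F \<le> 2"
  then have "3 \<le> card ?F" by simp
  then obtain T where T: "T \<subseteq> ?F" "card T = 3"
    by (meson obtain_subset_with_card_n)
  then obtain a b c where T_eq: "T = {a, b, c}" and ne: "a \<noteq> b" "a \<noteq> c" "b \<noteq> c"
    by (auto simp: card_3_iff)
  have linear: "int q dvd r + s * (x + y)" if "x \<in> ?F" "y \<in> ?F" "x \<noteq> y" for x y
  proof -
    have "int q dvd - (r * x + s * x\<^sup>2) - - (r * y + s * y\<^sup>2)"
      using that by (auto simp: mod_eq_dvd_iff[symmetric])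
    also have "\<dots> = (y - x) * (r + s * (x + y))"
      by algebra
    finally show ?thesis
      using that by (simp add: dvd_mult_iff dvd_diff_residues_iff)
  qed
  have in_F: "a \<in> ?F" "b \<in> ?F" "c \<in> ?F" using T T_eq by auto
  have "int q dvd (r + s * (a + b)) - (r + s * (a + c))"
    using in_F ne by (intro dvd_diff linear)
  also have "\<dots> = s * (b - c)" by (simp add: algebra_simps)
  finally have "int q dvd s"
    using in_F ne by (auto simp: dvd_mult_iff dvd_diff_residues_iff)
  moreover from this have "int q dvd r"
    using linear[OF in_F(1,2) ne(1)] by (simp add: dvd_add_left_iff)
  ultimately show False
    using assms dvd_diff_residues_iff[of _ q 0] q_pos by auto
qed

text \<open>All Fourier terms are nonnegative, and those with \<open>r = s = 0\<close> alone give
  \<open>q * (card X)\<^sup>2\<close>.\<close>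

lemma collinear_pairs_lower: "(real (card X))\<^sup>2 / q \<le> collinear_pairs (line q) {0..<int q} X"
proof -
  let ?K = "{0..<int q}"
  let ?t = "\<lambda>r s. \<Sum>k\<in>?K. (cmod (fourier X (- (r * k + s * k\<^sup>2)) r s))\<^sup>2"
  have "q * (real (card X))\<^sup>2 = ?t 0 0"
    by (simp add: fourier_def unity_char_def)
  also have "\<dots> \<le> (\<Sum>s\<in>?K. ?t 0 s)"
    using q_pos by (intro member_le_sum) (auto intro!: sum_nonneg)
  also have "\<dots> \<le> (\<Sum>r\<in>?K. \<Sum>s\<in>?K. ?t r s)"
    using q_pos by (intro member_le_sum[of 0 ?K "\<lambda>r. \<Sum>s\<in>?K. ?t r s"]) (auto intro!: sum_nonneg)
  finally have "q * (real (card X))\<^sup>2 \<le> real q ^ 2 * collinear_pairs (line q) {0..<int q} X"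
    by (simp only: collinear_pairs_fourier)
  then show ?thesis
    using q_pos by (simp add: divide_le_eq power2_eq_square mult_ac)
qed

text \<open>The terms with \<open>r = s = 0\<close> give the main term. Elsewhere each frequency is
  hit at most twice, so twice the Parseval sum bounds the rest.\<close>

lemma collinear_pairs_upper:
  assumes "X \<subseteq> {..<q ^ 3}"
  shows "collinear_pairs (line q) {0..<int q} X \<le> (real (card X))\<^sup>2 / q + 2 * q * card X"
proof -
  let ?K = "{0..<int q}"
  let ?G = "\<lambda>u r s. (cmod (fourier X u r s))\<^sup>2"
  let ?t = "\<lambda>r s. \<Sum>k\<in>?K. ?G (- (r * k + s * k\<^sup>2)) r s"
  have bound: "?t r s \<le> of_bool (r = 0) * (of_bool (s = 0) * (q * (real (card X))\<^sup>2)) + 2 * (\<Sum>u\<in>?K. ?G u r s)"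
    if rs: "r \<in> ?K" "s \<in> ?K" for r s
  proof (cases "(r, s) = (0, 0)")
    case True
    then have "?t r s = of_bool (r = 0) * (of_bool (s = 0) * (q * (real (card X))\<^sup>2))"
      by (simp add: fourier_def unity_char_def)
    moreover have "0 \<le> (\<Sum>u\<in>?K. ?G u r s)"
      by (intro sum_nonneg) simp
    ultimately show ?thesis by linarith
  next
    case False
    let ?\<phi> = "\<lambda>k. - (r * k + s * k\<^sup>2) mod int q"
    have "?t r s = (\<Sum>k\<in>?K. ?G (?\<phi> k) r s)"
      by (simp only: fourier_mod)
    also have "\<dots> = (\<Sum>u\<in>?K. \<Sum>k\<in>{k \<in> ?K. ?\<phi> k = u}. ?G (?\<phi> k) r s)"
      using q_pos by (intro sum.group[symmetric]) auto
    also have "\<dots> = (\<Sum>u\<in>?K. real (card {k \<in> ?K. ?\<phi> k = u}) * ?G u r s)"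
      by (intro sum.cong refl) simp
    also have "\<dots> \<le> (\<Sum>u\<in>?K. 2 * ?G u r s)"
      using card_quadratic_fibre_le[OF rs False]
      by (intro sum_mono mult_right_mono) (simp_all add: of_nat_le_iff[of _ 2, simplified])
    finally show ?thesis
      using False by (auto simp: sum_distrib_left)
  qed
  have "real q ^ 2 * collinear_pairs (line q) {0..<int q} X = (\<Sum>r\<in>?K. \<Sum>s\<in>?K. ?t r s)"
    by (rule collinear_pairs_fourier)
  also have "\<dots> \<le> (\<Sum>r\<in>?K. \<Sum>s\<in>?K. of_bool (r = 0) * (of_bool (s = 0) * (q * (real (card X))\<^sup>2))
      + 2 * (\<Sum>u\<in>?K. ?G u r s))"
    by (intro sum_mono bound)
  also have "\<dots> = q * (real (card X))\<^sup>2 + 2 * (\<Sum>r\<in>?K. \<Sum>s\<in>?K. \<Sum>u\<in>?K. ?G u r s)"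
    using q_pos by (simp add: sum.distrib sum_distrib_left[symmetric] sum_distrib_right[symmetric] of_bool_def)
  also have "\<dots> = q * (real (card X))\<^sup>2 + 2 * (real q ^ 3 * card X)"
    by (simp only: parseval[OF assms])
  also have "\<dots> = real q ^ 2 * ((real (card X))\<^sup>2 / q + 2 * q * card X)"
    using q_pos by (simp add: field_simps power2_eq_square power3_eq_cube)
  finally show ?thesis
    using q_pos by simp
qed

end

section \<open>The random graph\<close>

text \<open>Membership of \<open>(x, k)\<close> in \<open>A\<close> gives the side of
  \<open>x\<close> on its line in direction \<open>k\<close>, so the sides of a point on different
  lines are unrelated.\<close>

definition crossing_graph ::
  "('a \<Rightarrow> 'k \<Rightarrow> 'l) \<Rightarrow> 'k set \<Rightarrow> ('a \<times> 'k) set \<Rightarrow> 'a set \<Rightarrow> 'a set set" where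
  "crossing_graph L K A V =
     {{x, y} | x y k. x \<in> V \<and> y \<in> V \<and> k \<in> K \<and> L x k = L y k \<and> (x, k) \<in> A \<and> (y, k) \<notin> A}"

lemma simple_graph_crossing_graph:
  assumes "finite V"
  shows "simple_graph V (crossing_graph L K A V)"
  using assms by (auto simp: simple_graph_def crossing_graph_def card_2_iff)

text \<open>The factor \<open>(1 + ?s x) * (1 - ?s y)\<close> is 4 when \<open>x\<close> is on the
  \<open>A\<close> side and \<open>y\<close> is not, and 0 otherwise. Its linear terms cancel
  because collinearity is symmetric, leaving \<open>P - W\<close>.\<close>

lemma edges_in_crossing_graph:
  assumes fin: "finite V" "finite K" and X: "X \<subseteq> V"
    and unique: "\<And>x y j k. \<lbrakk>x \<in> V; y \<in> V; x \<noteq> y; j \<in> K; k \<in> K; L x j = L y j; L x k = L y k\<rbrakk> \<Longrightarrow> j = k"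
  shows "real (edges_in (crossing_graph L K A V) X) = (collinear_pairs L K X - signed_pairs L K A X) / 4"
proof -
  have finX: "finite X" using fin X finite_subset by blast
  \<comment> \<open>Listing the endpoint on the \<open>A\<close> side first, and having one
    direction per pair by \<open>unique\<close>, lets each edge correspond to exactly one
    triple.\<close>
  define T where "T = (SIGMA k:K. SIGMA x:X. {y \<in> X. L x k = L y k \<and> (x, k) \<in> A \<and> (y, k) \<notin> A})"
  have "bij_betw (\<lambda>(k, x, y). {x, y}) T {e \<in> crossing_graph L K A V. e \<subseteq> X}"
    unfolding bij_betw_def
  proof
    show "inj_on (\<lambda>(k, x, y). {x, y}) T"
    proof (rule inj_onI)
      fix s t
      assume st: "s \<in> T" "t \<in> T" "(case s of (k, x, y) \<Rightarrow> {x, y}) = (case t of (k, x, y) \<Rightarrow> {x, y})"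
      obtain k x y k' x' y' where eqs: "s = (k, x, y)" "t = (k', x', y')"
        by (metis surj_pair)
      with st have T: "(k, x, y) \<in> T" "(k', x', y') \<in> T" and eq: "{x, y} = {x', y'}"
        by simp_all
      have "x \<noteq> y" using T by (auto simp: T_def)
      have "L x k = L y k" "L x k' = L y k'" "k \<in> K" "k' \<in> K" "x \<in> V" "y \<in> V"
        using T eq X by (auto simp: T_def doubleton_eq_iff)
      then have "k = k'" using unique \<open>x \<noteq> y\<close> by blast
      then show "s = t"
        using T eq eqs by (auto simp: T_def doubleton_eq_iff)
    qed
    show "(\<lambda>(k, x, y). {x, y}) ` T = {e \<in> crossing_graph L K A V. e \<subseteq> X}"
    proof (intro subset_antisym subsetI)
      fix e assume "e \<in> (\<lambda>(k, x, y). {x, y}) ` T"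
      then obtain k x y where "e = {x, y}" "(k, x, y) \<in> T" by auto
      then show "e \<in> {e \<in> crossing_graph L K A V. e \<subseteq> X}"
        using X by (auto simp: T_def crossing_graph_def)
    next
      fix e assume "e \<in> {e \<in> crossing_graph L K A V. e \<subseteq> X}"
      then obtain x y k where e: "e = {x, y}"
        and "x \<in> X" "y \<in> X" "k \<in> K" "L x k = L y k" "(x, k) \<in> A" "(y, k) \<notin> A"
        unfolding crossing_graph_def by blast
      then have "(k, x, y) \<in> T" by (simp add: T_def)
      then show "e \<in> (\<lambda>(k, x, y). {x, y}) ` T" using e by force
    qed
  qed
  then have "edges_in (crossing_graph L K A V) X = card T"
    unfolding edges_in_def by (rule bij_betw_same_card[symmetric])
  also have "\<dots> = (\<Sum>k\<in>K. \<Sum>x\<in>X. card {y \<in> X. L x k = L y k \<and> (x, k) \<in> A \<and> (y, k) \<notin> A})"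
    using fin finX by (simp add: T_def)
  finally have card: "real (edges_in (crossing_graph L K A V) X)
      = (\<Sum>k\<in>K. \<Sum>x\<in>X. \<Sum>y\<in>X. of_bool (L x k = L y k \<and> (x, k) \<in> A \<and> (y, k) \<notin> A))"
    using finX by (simp add: Int_def)
  have "4 * (\<Sum>x\<in>X. \<Sum>y\<in>X. of_bool (L x k = L y k \<and> (x, k) \<in> A \<and> (y, k) \<notin> A))
      = (\<Sum>x\<in>X. \<Sum>y\<in>X. of_bool (L x k = L y k))
        - (\<Sum>x\<in>X. \<Sum>y\<in>X. of_bool (L x k = L y k) * sign A (x, k) * sign A (y, k))" for k
  proof -
    let ?a = "\<lambda>x y. of_bool (L x k = L y k) :: real"
    let ?s = "\<lambda>x. sign A (x, k)"
    have swap: "(\<Sum>x\<in>X. \<Sum>y\<in>X. ?a x y * ?s x) = (\<Sum>x\<in>X. \<Sum>y\<in>X. ?a x y * ?s y)"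
      by (subst sum.swap) (simp add: eq_commute)
    have "4 * (\<Sum>x\<in>X. \<Sum>y\<in>X. of_bool (L x k = L y k \<and> (x, k) \<in> A \<and> (y, k) \<notin> A))
        = (\<Sum>x\<in>X. \<Sum>y\<in>X. ?a x y + ?a x y * ?s x - ?a x y * ?s y - ?a x y * ?s x * ?s y)"
      unfolding sum_distrib_left by (intro sum.cong refl) (simp add: sign_def)
    also have "\<dots> = (\<Sum>x\<in>X. \<Sum>y\<in>X. ?a x y) - (\<Sum>x\<in>X. \<Sum>y\<in>X. ?a x y * ?s x * ?s y)"
      by (simp only: sum.distrib sum_subtractf swap)
    finally show ?thesis .
  qed
  then have "4 * real (edges_in (crossing_graph L K A V) X) = collinear_pairs L K X - signed_pairs L K A X"
    unfolding card sum_distrib_left[of 4 _ K] collinear_pairs_def signed_pairs_def sum_subtractf[symmetric]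
    by (simp only:)
  then show ?thesis by simp
qed

text \<open>The sides of a triangle share a direction, so its corners lie on one line; three points
  cannot be pairwise on opposite sides of a bipartition.\<close>

lemma triangle_free_crossing_graph:
  assumes "prime q"
  shows "triangle_free (crossing_graph (line q) {0..<int q} A {..<q ^ 3})"
  unfolding triangle_free_def
proof clarify
  let ?E = "crossing_graph (line q) {0..<int q} A {..<q ^ 3}"
  fix x y z
  assume E: "{x, y} \<in> ?E" "{y, z} \<in> ?E" "{x, z} \<in> ?E"
  have edge: "x < q ^ 3 \<and> y < q ^ 3 \<and> x \<noteq> y \<and>
      (\<exists>k\<in>{0..<int q}. line q x k = line q y k \<and> ((x, k) \<in> A \<longleftrightarrow> (y, k) \<notin> A))"
    if "{x, y} \<in> ?E" for x y
    using that unfolding crossing_graph_def by (fastforce simp: doubleton_eq_iff)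
  obtain i j k where K: "i \<in> {0..<int q}" "j \<in> {0..<int q}" "k \<in> {0..<int q}"
    and lines: "line q x i = line q y i" "line q y j = line q z j" "line q x k = line q z k"
    and cross: "(x, i) \<in> A \<longleftrightarrow> (y, i) \<notin> A" "(y, j) \<in> A \<longleftrightarrow> (z, j) \<notin> A" "(x, k) \<in> A \<longleftrightarrow> (z, k) \<notin> A"
    using edge[OF E(1)] edge[OF E(2)] edge[OF E(3)] by blast
  have "i = j" "j = k"
    using triangle_same_direction[OF assms, of x y z i j k] K lines
      edge[OF E(1)] edge[OF E(2)] edge[OF E(3)] by auto
  then show False using cross by blast
qed

text \<open>The main term \<open>m\<^sup>2 / (4 * q)\<close> of the edge count fixes the density;
  what remains is a quarter of \<open>P + m / q - W\<close>, whose pieces are all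
  \<open>O(q * m * ln q)\<close>.\<close>

lemma exists_jumbled_triangle_free_graph:
  assumes q: "prime q"
  shows "\<exists>E. simple_graph {..<q ^ 3} E \<and> triangle_free E \<and>
    jumbled {..<q ^ 3} E (1 / (2 * real q)) (3 * real q * ln (real (q ^ 3)))"
proof -
  let ?V = "{..<q ^ 3}" and ?K = "{0..<int q}" and ?L = "line q"
  let ?l = "ln (real (q ^ 3))"
  have q2: "q \<ge> 2" using q by (rule prime_ge_2_nat)
  \<comment> \<open>The logarithm is thus at least 1 and can absorb additive constants.\<close>
  have "exp 1 \<le> (2::real) ^ 3" using exp_le by simp
  also have "\<dots> \<le> real q ^ 3" using q2 by (intro power_mono) auto
  finally have ln_ge: "?l \<ge> 1" using q2 by (simp add: ln_ge_iff)
  have "\<exists>A. \<forall>X\<subseteq>?V. X \<noteq> {} \<longrightarrow>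
      signed_pairs ?L ?K A X \<le> 4 * real q * real (card X) * (3 / 2 + ln (real (card ?V)))"
    using q2 by (intro exists_signs_small_signed_pairs card_line_le) (auto simp: lessThan_empty_iff)
  then obtain A where A: "\<And>X. X \<subseteq> ?V \<Longrightarrow> X \<noteq> {} \<Longrightarrow>
      signed_pairs ?L ?K A X \<le> 4 * real q * real (card X) * (3 / 2 + ?l)"
    by auto
  let ?E = "crossing_graph ?L ?K A ?V"
  have "\<bar>real (edges_in ?E X) - 1 / (2 * real q) * real (card X choose 2)\<bar>
      \<le> 3 * real q * ?l * real (card X)" if X: "X \<subseteq> ?V" for X
  proof (cases "X = {}")
    case True
    have "{} \<notin> ?E" by (auto simp: crossing_graph_def)
    then have "{e \<in> ?E. e \<subseteq> {}} = {}" by auto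
    then show ?thesis using True by (simp add: edges_in_def numeral_2_eq_2)
  next
    case False
    define m where "m = real (card X)"
    \<comment> \<open>Here \<open>P\<close> is the excess over the main term, not the whole
      collinear count.\<close>
    define P where "P = collinear_pairs ?L ?K X - m\<^sup>2 / q"
    define W where "W = signed_pairs ?L ?K A X"
    have finX: "finite X" using X finite_subset by blast
    have m: "m \<ge> 1" using False finX by (simp add: m_def Suc_le_eq card_gt_0_iff)
    have edges: "real (edges_in ?E X) = (m\<^sup>2 / q + P - W) / 4"
      using edges_in_crossing_graph[of ?V ?K X ?L A] X two_lines_eq[OF q]
      by (simp add: P_def W_def)
    have choose: "real (card X choose 2) = (m\<^sup>2 - m) / 2"
      by (simp add: m_def choose_two real_of_nat_div power2_eq_square algebra_simps of_nat_diff)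
    have diff: "real (edges_in ?E X) - 1 / (2 * real q) * real (card X choose 2) = (P + m / q - W) / 4"
      unfolding edges choose using q2 by (simp add: field_simps)
    have "P \<ge> 0" "P \<le> 2 * real q * m"
      using collinear_pairs_lower[OF q, of X] collinear_pairs_upper[OF q X] by (simp_all add: P_def m_def)
    moreover have "0 \<le> m / q" "m / q \<le> real q * m"
    proof -
      have "m / q \<le> m / 1" using m q2 by (intro divide_left_mono) auto
      also have "\<dots> \<le> real q * m" using m q2 by simp
      finally show "m / q \<le> real q * m" .
    qed (use m in simp)
    moreover have "W \<ge> 0" unfolding W_def using finX by (intro signed_pairs_nonneg) auto
    \<comment> \<open>The constant is \<open>4 * (5 / 2)\<close>; a quarter of it stays below 3, as
      does the quarter of \<open>2 + 1\<close> from \<open>P\<close> and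
      \<open>m / q\<close>.\<close>
    moreover have "W \<le> 10 * (real q * m * ?l)"
    proof -
      have "W \<le> 4 * real q * m * (3 / 2 + ?l)" using A[OF X False] by (simp add: W_def m_def)
      also have "\<dots> \<le> 4 * real q * m * (5 / 2 * ?l)"
        using ln_ge m by (intro mult_left_mono) auto
      finally show ?thesis by (simp add: mult_ac)
    qed
    moreover have "real q * m \<le> real q * m * ?l"
      using mult_left_mono[OF ln_ge, of "real q * m"] m by simp
    ultimately have "\<bar>(P + m / q - W) / 4\<bar> \<le> 3 * (real q * m * ?l)"
      by (simp add: abs_le_iff)
    then show ?thesis unfolding diff by (simp add: m_def mult_ac)
  qed
  then have "jumbled ?V ?E (1 / (2 * real q)) (3 * real q * ?l)"
    unfolding jumbled_def by blast
  then show ?thesis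
    using simple_graph_crossing_graph[of ?V] triangle_free_crossing_graph[OF q] by blast
qed

section \<open>The sequence of cubes of primes\<close>

theorem theorem1:
  shows "\<exists>(n :: nat \<Rightarrow> nat) (c :: real) (C :: real).
     strict_mono n \<and> (\<forall>i. n i > 0) \<and> c > 0 \<and> C > 0 \<and>
     (\<forall>i. \<exists>(E :: nat set set) (p :: real) (\<beta> :: real).
        simple_graph {..<n i} E \<and> triangle_free E \<and>
        0 < p \<and> p \<le> 1 \<and>
        jumbled {..<n i} E p \<beta> \<and>
        p \<ge> c * real (n i) powr (-1/3) \<and>
        \<beta> \<le> C * sqrt (p * real (n i)) * ln (real (n i)))"
proof -
  define q where "q = enumerate {p :: nat. prime p}"
  have prime: "prime (q i)" for i
    using enumerate_in_set[OF primes_infinite, of i] by (simp add: q_def)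
  have mono: "strict_mono q"
    unfolding q_def using strict_mono_enumerate[OF primes_infinite] .
  show ?thesis
  \<comment> \<open>For \<open>n = q ^ 3\<close> the power \<open>n powr (-1/3)\<close> is
    \<open>1 / q\<close>, so \<open>p = 1 / (2 * q)\<close> gives \<open>c = 1 / 2\<close>. As
    \<open>p * n = q\<^sup>2 / 2\<close>, its root is at least \<open>q / 2\<close>, and
    \<open>3 * q\<close> is at most 6 times that root.\<close>
  proof (rule exI[of _ "\<lambda>i. q i ^ 3"], rule exI[of _ "1 / 2"], rule exI[of _ 6], intro conjI allI)
    show "strict_mono (\<lambda>i. q i ^ 3)"
      using mono by (simp add: strict_mono_def power_strict_mono)
    show "q i ^ 3 > 0" for i
      using prime_gt_0_nat[OF prime] by simp
    fix i
    have q2: "q i \<ge> 2" using prime by (rule prime_ge_2_nat)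
    obtain E where E: "simple_graph {..<q i ^ 3} E" "triangle_free E"
      "jumbled {..<q i ^ 3} E (1 / (2 * real (q i))) (3 * real (q i) * ln (real (q i ^ 3)))"
      using exists_jumbled_triangle_free_graph[OF prime] by blast
    have "real (q i ^ 3) powr (-1 / 3) = real (q i) powr (3 * (-1 / 3))"
      using q2 by (simp only: powr_powr[symmetric]) (simp add: powr_numeral)
    also have "\<dots> = 1 / real (q i)"
      using q2 by (simp add: powr_minus_divide)
    finally have dens: "1 / 2 * real (q i ^ 3) powr (-1 / 3) \<le> 1 / (2 * real (q i))"
      by simp
    have "real (q i) / 2 = sqrt ((real (q i) / 2)\<^sup>2)"
      by simp
    also have "\<dots> \<le> sqrt (1 / (2 * real (q i)) * real (q i ^ 3))"
      using q2 by (intro real_sqrt_le_mono) (simp add: field_simps power2_eq_square power3_eq_cube)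
    finally have "3 * real (q i) \<le> 6 * sqrt (1 / (2 * real (q i)) * real (q i ^ 3))"
      by simp
    then have "3 * real (q i) * ln (real (q i ^ 3))
        \<le> 6 * sqrt (1 / (2 * real (q i)) * real (q i ^ 3)) * ln (real (q i ^ 3))"
      using q2 by (intro mult_right_mono) auto
    then show "\<exists>(E :: nat set set) (p :: real) (\<beta> :: real).
        simple_graph {..<q i ^ 3} E \<and> triangle_free E \<and> 0 < p \<and> p \<le> 1 \<and>
        jumbled {..<q i ^ 3} E p \<beta> \<and> p \<ge> 1 / 2 * real (q i ^ 3) powr (-1 / 3) \<and>
        \<beta> \<le> 6 * sqrt (p * real (q i ^ 3)) * ln (real (q i ^ 3))"
      using E dens q2
      by (intro exI[of _ E] exI[of _ "1 / (2 * real (q i))"]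
          exI[of _ "3 * real (q i) * ln (real (q i ^ 3))"]) auto
  qed auto
qed

end
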